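(* Let $\Omega\subset\mathbb{R}^n$ be a convex smooth bounded domain such that for every $y_0\in\partial\Omega$ there is a hyperplane $S_{y_0}$ tangent to $\Omega$ at $y_0$ with $S_{y_0}\cap\partial\Omega=\{y_0\}$. Let $1<p<2$, $\lambda>0$, and let $f:[0,\infty)\to\mathbb{R}$ satisfy $f(s)>0$, $f'(s)<0$ for $s\ge0$ and $\int_0^\infty f(s)\,ds=1$. Let $u_0$ be continuous on $\overline\Omega$ with $u_0\ge0$ in $\Omega$ and $u_0=0$ on $\partial\Omega$. Then the solution $u$ of \[ u_t=\Delta u+\frac{\lambda f(u)}{\big(\int_\Omega f(u)\,dx\big)^p}\ \text{in }\Omega\times(0,\infty),\quad u=0 \text{ on }\partial\Omega\times(0,\infty),\quad u(\cdot,0)=u_0 \] is globally bounded. *)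

theory Defs
  imports "HOL-Analysis.Analysis"
begin

inductive dirs :: "('a::real_normed_vector) set \<Rightarrow> ('a \<Rightarrow> real) \<Rightarrow> 'a list \<Rightarrow> ('a \<Rightarrow> real) \<Rightarrow> bool"
  for S f where
  dirs_Nil: "dirs S f [] f"
| dirs_Cons: "\<lbrakk> dirs S f vs h;
               \<forall>x\<in>S. ((\<lambda>s. h (x + s *\<^sub>R v)) has_real_derivative g x) (at 0);
               \<forall>x. x \<notin> S \<longrightarrow> g x = 0 \<rbrakk> \<Longrightarrow> dirs S f (v # vs) g"

definition Ck_on :: "nat \<Rightarrow> ('a::real_normed_vector) set \<Rightarrow> ('a \<Rightarrow> real) \<Rightarrow> bool" where
  "Ck_on k S f \<longleftrightarrow> open S \<and>
     (\<forall>vs. length vs \<le> k \<longrightarrow> (\<exists>g. dirs S f vs g \<and> continuous_on S g))"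

definition smooth_on :: "('a::real_normed_vector) set \<Rightarrow> ('a \<Rightarrow> real) \<Rightarrow> bool" where
  "smooth_on S f \<longleftrightarrow> (\<forall>k. Ck_on k S f)"

(* Laplacian of f at x (for f \<in> C^2(S), S open) *)
definition laplacian :: "(real^'n) set \<Rightarrow> (real^'n \<Rightarrow> real) \<Rightarrow> real^'n \<Rightarrow> real" where
  "laplacian S f x = (\<Sum>i\<in>UNIV. (THE g. dirs S f [axis i 1, axis i 1] g) x)"

definition local_defining_fun ::
  "(real^'n) set \<Rightarrow> real^'n \<Rightarrow> (real^'n) set \<Rightarrow> (real^'n \<Rightarrow> real) \<Rightarrow> real^'n \<Rightarrow> bool" where
  "local_defining_fun \<Omega> y U \<phi> a \<longleftrightarrow>
     open U \<and> y \<in> U \<and> smooth_on U \<phi> \<and> a \<noteq> 0 \<and>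
     (\<phi> has_derivative (\<lambda>h. a \<bullet> h)) (at y) \<and>
     \<Omega> \<inter> U = {x \<in> U. \<phi> x < 0}"

definition smooth_bounded_domain :: "(real^'n) set \<Rightarrow> bool" where
  "smooth_bounded_domain \<Omega> \<longleftrightarrow> open \<Omega> \<and> connected \<Omega> \<and> \<Omega> \<noteq> {} \<and> bounded \<Omega> \<and>
     (\<forall>y\<in>frontier \<Omega>. \<exists>U \<phi> a. local_defining_fun \<Omega> y U \<phi> a)"

definition tangent_hyperplane :: "(real^'n) set \<Rightarrow> real^'n \<Rightarrow> (real^'n) set \<Rightarrow> bool" where
  "tangent_hyperplane \<Omega> y0 S \<longleftrightarrow>
     (\<exists>U \<phi> a. local_defining_fun \<Omega> y0 U \<phi> a \<and> S = {x. a \<bullet> (x - y0) = 0})"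

definition classical_solution ::
  "(real^'n) set \<Rightarrow> real \<Rightarrow> real \<Rightarrow> (real \<Rightarrow> real) \<Rightarrow> (real^'n \<Rightarrow> real) \<Rightarrow> real
     \<Rightarrow> (real^'n \<Rightarrow> real \<Rightarrow> real) \<Rightarrow> bool" where
  "classical_solution \<Omega> lam p f u0 T u \<longleftrightarrow>
     continuous_on (closure \<Omega> \<times> {0..<T}) (\<lambda>(x, t). u x t) \<and>
     (\<forall>x\<in>closure \<Omega>. \<forall>t\<in>{0..<T}. 0 \<le> u x t) \<and>
     (\<forall>x\<in>closure \<Omega>. u x 0 = u0 x) \<and>
     (\<forall>x\<in>frontier \<Omega>. \<forall>t\<in>{0<..<T}. u x t = 0) \<and>
     (\<forall>t\<in>{0<..<T}. Ck_on 2 \<Omega> (\<lambda>x. u x t)) \<and>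
     (\<forall>x\<in>\<Omega>. \<forall>t\<in>{0<..<T}.
        ((\<lambda>s. u x s) has_real_derivative
           (laplacian \<Omega> (\<lambda>y. u y t) x
             + lam * f (u x t) / (integral \<Omega> (\<lambda>y. f (u y t))) powr p)) (at t))"

end

theory Submission
  imports Defs
begin

text \<open>
  Let \<open>W\<close> solve \<open>W' = sqrt (2 F(W))\<close> with \<open>F(s) = \<integral>\<^sub>s\<^sup>\<infinity> f\<close> and \<open>W(0) > max u0\<close>, so that \<open>W'' = - f(W)\<close>.
  The solution stays below \<open>V(x) = W(dist(x, \<partial>\<Omega>) / d)\<close> once \<open>d\<close> is small. At a first touching point
  \<open>(x0, t0)\<close>, a supporting half-space at the boundary point nearest to \<open>x0\<close> replaces the distance by an
  affine function that dominates it and agrees with it at \<open>x0\<close>, which gives \<open>\<Delta>u \<le> - f(u) / d\<^sup>2\<close> there.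
  Since \<open>u \<le> V\<close> at time \<open>t0\<close>, \<open>f(u)\<close> is bounded below on a boundary layer of measure at least a
  multiple of \<open>d\<close>, hence \<open>\<integral>\<^sub>\<Omega> f(u) \<ge> c d\<close>, and \<open>lam / (c d)\<^sup>p < 1 / d\<^sup>2\<close> for small \<open>d\<close> because \<open>p < 2\<close>.
  So \<open>u\<^sub>t < 0\<close> at the touching point, which is impossible.
\<close>

section \<open>Second-order comparison at a touching point\<close>

text \<open>The maximum forces \<open>\<psi> 0 = 0\<close>. If \<open>c\<close> were positive,
  \<open>\<psi>\<close> would be positive just to the right of 0, and the mean value theorem would
  push \<open>\<phi>\<close> above \<open>\<phi> 0\<close>.\<close>

lemma second_derivative_nonpos_at_local_max:
  fixes \<phi> \<psi> :: "real \<Rightarrow> real"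
  assumes d1: "\<forall>\<^sub>F s in nhds 0. (\<phi> has_real_derivative \<psi> s) (at s)"
    and d2: "(\<psi> has_real_derivative c) (at 0)"
    and max: "\<forall>\<^sub>F s in nhds 0. \<phi> s \<le> \<phi> 0"
  shows "c \<le> 0"
proof (rule ccontr)
  assume "\<not> c \<le> 0"
  then have c: "0 < c" by simp
  obtain d where d: "d > 0" and dd: "\<And>s. \<bar>s\<bar> < d \<Longrightarrow> (\<phi> has_real_derivative \<psi> s) (at s) \<and> \<phi> s \<le> \<phi> 0"
    using eventually_conj[OF d1 max] unfolding eventually_nhds_metric by (auto simp: dist_real_def)
  have "\<psi> 0 = 0"
    using DERIV_local_max[of \<phi> "\<psi> 0" 0 d] dd d by auto
  with DERIV_pos_inc_right[OF d2 c] obtain e where e: "e > 0" "\<And>h. 0 < h \<Longrightarrow> h < e \<Longrightarrow> 0 < \<psi> h"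
    by auto
  define m where "m = min d e / 2"
  have m: "0 < m" "m < d" "m < e" using d e by (auto simp: m_def min_def)
  obtain z where z: "0 < z" "z < m" "\<phi> m - \<phi> 0 = (m - 0) * \<psi> z"
    using MVT2[of 0 m \<phi> \<psi>] dd m by fastforce
  have "0 < m * \<psi> z" using z m e by auto
  moreover have "\<phi> m \<le> \<phi> 0" using dd[of m] m by auto
  ultimately show False using z by auto
qed

text \<open>Needed because \<open>laplacian\<close> is defined through \<open>THE\<close>. On
  \<open>S\<close> derivatives are unique; off \<open>S\<close> the convention of vanishing there
  makes the functions themselves equal.\<close>

lemma dirs_unique: "dirs S f vs g \<Longrightarrow> dirs S f vs h \<Longrightarrow> g = h"
proof (induction arbitrary: h rule: dirs.induct)
  case dirs_Nil
  then show ?case by (auto elim: dirs.cases)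
next
  case (dirs_Cons vs h1 v g1)
  from dirs_Cons.prems obtain h2 where h2: "dirs S f vs h2"
    "\<forall>x\<in>S. ((\<lambda>s. h2 (x + s *\<^sub>R v)) has_real_derivative h x) (at 0)" "\<forall>x. x \<notin> S \<longrightarrow> h x = 0"
    by (auto elim: dirs.cases)
  have "h1 = h2" using dirs_Cons.IH h2 by blast
  show ?case
  proof
    fix x show "g1 x = h x"
      using dirs_Cons.hyps h2 \<open>h1 = h2\<close> by (cases "x \<in> S") (auto intro: DERIV_unique)
  qed
qed

lemma Ck_on_2_obtains_derivs:
  fixes v :: "real^'n \<Rightarrow> real"
  assumes "Ck_on 2 \<Omega> v"
  obtains h g where
    "\<And>i y. y \<in> \<Omega> \<Longrightarrow> ((\<lambda>s. v (y + s *\<^sub>R axis i 1)) has_real_derivative h i y) (at 0)"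
    "\<And>i y. y \<in> \<Omega> \<Longrightarrow> ((\<lambda>s. h i (y + s *\<^sub>R axis i 1)) has_real_derivative g i y) (at 0)"
    "\<And>y. laplacian \<Omega> v y = (\<Sum>i\<in>UNIV. g i y)"
proof -
  have "\<exists>g. dirs \<Omega> v [axis i 1, axis i 1] g" for i :: 'n
    using assms unfolding Ck_on_def by (metis One_nat_def length_Cons list.size(3) numeral_2_eq_2 order_refl)
  then obtain g where g: "\<And>i. dirs \<Omega> v [axis i 1, axis i 1] (g i)" by metis
  have "\<exists>h. dirs \<Omega> v [axis i 1] h \<and> (\<forall>y\<in>\<Omega>. ((\<lambda>s. h (y + s *\<^sub>R axis i 1)) has_real_derivative g i y) (at 0))" for i
    using g[of i] by (auto elim: dirs.cases)
  then obtain h where h: "\<And>i. dirs \<Omega> v [axis i 1] (h i)"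
     "\<And>i y. y \<in> \<Omega> \<Longrightarrow> ((\<lambda>s. h i (y + s *\<^sub>R axis i 1)) has_real_derivative g i y) (at 0)" by metis
  have h0: "\<And>i y. y \<in> \<Omega> \<Longrightarrow> ((\<lambda>s. v (y + s *\<^sub>R axis i 1)) has_real_derivative h i y) (at 0)"
    using h(1) by (auto elim!: dirs.cases[of _ _ "[_]"] elim: dirs.cases[of _ _ "[]"])
  have "laplacian \<Omega> v y = (\<Sum>i\<in>UNIV. g i y)" for y
    unfolding laplacian_def using the_equality[of "dirs \<Omega> v [axis _ 1, axis _ 1]", OF g dirs_unique[OF _ g]]
    by simp
  with h h0 that show thesis by blast
qed

text \<open>Along each coordinate line through \<open>x\<close>, the difference of \<open>v\<close>
  and \<open>V (b - a \<bullet> y)\<close> has a local maximum. The second derivative of the latter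
  in direction \<open>i\<close> is \<open>k * (a $ i)\<^sup>2\<close>, and these sum to
  \<open>k\<close> since \<open>a\<close> is a unit vector.\<close>

lemma laplacian_le_of_touching:
  fixes v :: "real^'n \<Rightarrow> real"
  assumes C2: "Ck_on 2 \<Omega> v" and x: "x \<in> \<Omega>" and a: "norm a = 1"
    and pos: "\<And>y. y \<in> \<Omega> \<Longrightarrow> 0 < b - a \<bullet> y"
    and le: "\<And>y. y \<in> \<Omega> \<Longrightarrow> v y \<le> V (b - a \<bullet> y)" and eq: "v x = V (b - a \<bullet> x)"
    and V1: "\<And>r. 0 < r \<Longrightarrow> (V has_real_derivative V' r) (at r)"
    and V2: "(V' has_real_derivative k) (at (b - a \<bullet> x))"
  shows "laplacian \<Omega> v x \<le> k"
proof -
  obtain h g where h: "\<And>i y. y \<in> \<Omega> \<Longrightarrow> ((\<lambda>s. v (y + s *\<^sub>R axis i 1)) has_real_derivative h i y) (at 0)"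
    and g: "\<And>i y. y \<in> \<Omega> \<Longrightarrow> ((\<lambda>s. h i (y + s *\<^sub>R axis i 1)) has_real_derivative g i y) (at 0)"
    and lap: "\<And>y. laplacian \<Omega> v y = (\<Sum>i\<in>UNIV. g i y)"
    using Ck_on_2_obtains_derivs[OF C2] by blast
  have op: "open \<Omega>" using C2 by (simp add: Ck_on_def)
  have gi: "g i x \<le> k * (a $ i)\<^sup>2" for i
  proof -
    define L where "L s = x + s *\<^sub>R axis i (1::real)" for s
    have aL: "b - a \<bullet> L s = (b - a \<bullet> x) - s * a $ i" for s
      by (simp add: L_def inner_right_distrib inner_axis algebra_simps)
    have "open (L -` \<Omega>)" unfolding L_def by (intro open_vimage op continuous_intros)
    then have ev: "\<forall>\<^sub>F s in nhds 0. L s \<in> \<Omega>"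
      using x eventually_nhds_in_open[of "L -` \<Omega>" 0] by (simp add: L_def)
    define \<phi> where "\<phi> s = v (L s) - V (b - a \<bullet> L s)" for s
    define \<psi> where "\<psi> s = h i (L s) + V' (b - a \<bullet> L s) * a $ i" for s
    have d1: "(\<phi> has_real_derivative \<psi> s) (at s)" if "L s \<in> \<Omega>" for s
    proof -
      \<comment> \<open>Partial derivatives are given at parameter 0 from a moving base point.
        Writing 0 as \<open>s + - s\<close> lets the derivative be shifted to parameter
        \<open>s\<close> on the fixed line \<open>L\<close>.\<close>
      have "((\<lambda>r. v (L s + r *\<^sub>R axis i 1)) has_real_derivative h i (L s)) (at (s + - s))"
        using h[OF that] by simp
      then have "((\<lambda>r. v (L s + (r + - s) *\<^sub>R axis i 1)) has_real_derivative h i (L s)) (at s)"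
        by (simp only: DERIV_shift)
      moreover have "L s + (r + - s) *\<^sub>R axis i 1 = L r" for r
        by (simp add: L_def algebra_simps)
      ultimately have 1: "((\<lambda>r. v (L r)) has_real_derivative h i (L s)) (at s)" by simp
      have "((\<lambda>r. V ((b - a \<bullet> x) - r * a $ i)) has_real_derivative V' ((b - a \<bullet> x) - s * a $ i) * (- a $ i)) (at s)"
        by (rule DERIV_chain2[OF V1]) (use pos[OF that] in \<open>auto simp: aL intro!: derivative_eq_intros\<close>)
      from DERIV_diff[OF 1 this] show ?thesis
        unfolding \<phi>_def \<psi>_def aL by simp
    qed
    have "((\<lambda>r. V' ((b - a \<bullet> x) - r * a $ i)) has_real_derivative k * (- a $ i)) (at 0)"
      by (rule DERIV_chain2[where g="\<lambda>r. (b - a \<bullet> x) - r * a $ i"])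
        (use V2 in \<open>auto intro!: derivative_eq_intros\<close>)
    from DERIV_cmult_right[OF this, of "a $ i"]
    have "((\<lambda>r. V' ((b - a \<bullet> x) - r * a $ i) * a $ i) has_real_derivative - (k * (a $ i)\<^sup>2)) (at 0)"
      by (simp add: power2_eq_square algebra_simps)
    from DERIV_add[OF g[OF x, of i] this]
    have d2: "(\<psi> has_real_derivative g i x - k * (a $ i)\<^sup>2) (at 0)"
      unfolding \<psi>_def aL by (simp add: L_def)
    have "\<phi> 0 = 0" using eq by (simp add: \<phi>_def L_def)
    then have "g i x - k * (a $ i)\<^sup>2 \<le> 0"
      using le by (intro second_derivative_nonpos_at_local_max[OF _ d2, where \<phi>=\<phi>] eventually_mono[OF ev] d1)
        (auto simp: \<phi>_def)
    then show ?thesis by simp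
  qed
  have "(\<Sum>i\<in>UNIV. (a $ i)\<^sup>2) = 1"
    using a by (simp add: norm_eq_1 inner_vec_def power2_eq_square)
  then have "(\<Sum>i\<in>UNIV. k * (a $ i)\<^sup>2) = k" by (simp flip: sum_distrib_left)
  then show ?thesis unfolding lap using sum_mono[of UNIV "\<lambda>i. g i x", OF gi] by simp
qed

section \<open>Distance to the boundary and boundary layers\<close>

text \<open>The segment from \<open>x\<close> to \<open>z\<close> leaves \<open>S\<close>, so it
  crosses the frontier at a point no farther from \<open>x\<close> than \<open>z\<close>.\<close>

lemma infdist_frontier_le_dist:
  fixes x z :: "'a::real_normed_vector"
  assumes "x \<in> S" "z \<notin> S"
  shows "infdist x (frontier S) \<le> dist x z"
proof -
  have "closed_segment x z \<inter> frontier S \<noteq> {}"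
    using assms by (intro connected_Int_frontier) auto
  then obtain w where w: "w \<in> closed_segment x z" "w \<in> frontier S" by blast
  then show ?thesis
    using infdist_le[OF w(2), of x] segment_bound(1)[OF w(1)] by (simp add: dist_norm norm_minus_commute)
qed

text \<open>Moving from \<open>x\<close> along the unit outward normal \<open>a\<close> by
  \<open>a \<bullet> y - a \<bullet> x\<close> reaches the supporting hyperplane at
  \<open>y\<close>, hence a point outside \<open>\<Omega>\<close>. The distance to the frontier is
  therefore at most this length.\<close>

lemma supporting_halfspace_infdist:
  fixes \<Omega> :: "'a::euclidean_space set"
  assumes op: "open \<Omega>" and cvx: "convex \<Omega>" and ne: "\<Omega> \<noteq> {}" and y: "y \<in> frontier \<Omega>"
  obtains a where "norm a = 1" "\<And>x. x \<in> \<Omega> \<Longrightarrow> 0 < a \<bullet> y - a \<bullet> x"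
    "\<And>x. x \<in> \<Omega> \<Longrightarrow> infdist x (frontier \<Omega>) \<le> a \<bullet> y - a \<bullet> x"
proof -
  have ri: "rel_interior \<Omega> = \<Omega>" by (simp add: op rel_interior_open)
  have "y \<in> closure \<Omega>" "y \<notin> rel_interior \<Omega>"
    using y op ri by (auto simp: frontier_def interior_open)
  from supporting_hyperplane_relative_frontier[OF cvx this] obtain c where
    c: "c \<noteq> 0" "\<And>x. x \<in> \<Omega> \<Longrightarrow> c \<bullet> y < c \<bullet> x" unfolding ri by metis
  define a where "a = (- 1 / norm c) *\<^sub>R c"
  have na: "norm a = 1" using c by (simp add: a_def)
  have pos: "0 < a \<bullet> y - a \<bullet> x" if "x \<in> \<Omega>" for x
    using c(2)[OF that] c(1) by (simp add: a_def field_simps)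
  have "infdist x (frontier \<Omega>) \<le> a \<bullet> y - a \<bullet> x" if x: "x \<in> \<Omega>" for x
  proof -
    define z where "z = x + (a \<bullet> y - a \<bullet> x) *\<^sub>R a"
    have "a \<bullet> z = a \<bullet> y"
      using na by (simp add: z_def inner_right_distrib norm_eq_1)
    then have "z \<notin> \<Omega>" using pos by force
    from infdist_frontier_le_dist[OF x this] show ?thesis
      using pos[OF x] na by (simp add: z_def dist_norm)
  qed
  with na pos that show thesis by blast
qed

text \<open>The layer is \<open>\<Omega>\<close> minus its homothetic copy of ratio \<open>1 - d\<close> centred at \<open>z\<close>.\<close>

lemma boundary_layer_measure:
  fixes \<Omega> :: "'a::euclidean_space set"
  assumes op: "open \<Omega>" and cvx: "convex \<Omega>" and z: "z \<in> \<Omega>" and R: "\<Omega> \<subseteq> cball z R"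
    and d: "0 < d" "d \<le> 1/2"
  obtains N where "N \<in> lmeasurable" "N \<subseteq> \<Omega>" "d * measure lebesgue \<Omega> \<le> measure lebesgue N"
    "\<And>x. x \<in> N \<Longrightarrow> infdist x (frontier \<Omega>) \<le> 2 * R * d"
proof -
  define T where "T x = (1 - d) *\<^sub>R x + d *\<^sub>R z" for x
  have bdd: "bounded \<Omega>" using R bounded_cball bounded_subset by blast
  have lm: "\<Omega> \<in> lmeasurable" by (simp add: bdd op lmeasurable_open)
  have T: "T ` \<Omega> = (+) (d *\<^sub>R z) ` ((*\<^sub>R) (1 - d) ` \<Omega>)"
    by (auto simp: T_def image_image add.commute)
  have "open (T ` \<Omega>)" unfolding T using op d by (intro open_translation open_scaling) auto
  moreover have "bounded (T ` \<Omega>)" unfolding T using bdd by (intro bounded_translation bounded_scaling)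
  ultimately have lmT: "T ` \<Omega> \<in> lmeasurable" by (simp add: lmeasurable_open)
  have "measure lebesgue (T ` \<Omega>) = \<bar>1 - d\<bar> ^ DIM('a) * measure lebesgue \<Omega>"
    unfolding T_def by (rule measure_lebesgue_affine)
  \<comment> \<open>The dimension is at least 1, so the contraction factor \<open>1 - d\<close>
    bounds its own power.\<close>
  also have "\<dots> \<le> (1 - d) * measure lebesgue \<Omega>"
    using d power_decreasing[of 1 "DIM('a)" "1 - d"] by (intro mult_right_mono) auto
  finally have m: "measure lebesgue (T ` \<Omega>) \<le> (1 - d) * measure lebesgue \<Omega>" .
  show thesis
  proof
    show "\<Omega> - T ` \<Omega> \<in> lmeasurable" using lm lmT by (intro fmeasurable.Diff) auto
    show "d * measure lebesgue \<Omega> \<le> measure lebesgue (\<Omega> - T ` \<Omega>)"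
      using measure_diff_le_measure_setdiff[OF lm lmT] m by (simp add: algebra_simps)
    fix x assume x: "x \<in> \<Omega> - T ` \<Omega>"
    define q where "q = d / (1 - d)"
    have q: "0 \<le> q" "q \<le> 2 * d" using d by (auto simp: q_def field_simps)
    define w where "w = x + q *\<^sub>R (x - z)"
    have "(1 - d) * q = d" "(1 - d) * (1 + q) = 1" using d by (auto simp: q_def field_simps)
    moreover have "T w = ((1 - d) * (1 + q)) *\<^sub>R x + (d - (1 - d) * q) *\<^sub>R z"
      by (simp add: T_def w_def algebra_simps)
    ultimately have "T w = x" by simp
    then have "w \<notin> \<Omega>" using x by force
    then have "infdist x (frontier \<Omega>) \<le> dist x w" using x infdist_frontier_le_dist by blast
    also have "\<dots> = q * dist z x" using q by (simp add: w_def dist_norm norm_minus_commute)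
    also have "\<dots> \<le> (2 * d) * R" using x R q d by (intro mult_mono) auto
    finally show "infdist x (frontier \<Omega>) \<le> 2 * R * d" by (simp add: algebra_simps)
  qed auto
qed

section \<open>The one-dimensional profile\<close>

text \<open>Separation of variables: \<open>W\<close> inverts \<open>G\<close>, a primitive of the
  reciprocal of \<open>sqrt (2 * F v)\<close>. The bound \<open>F \<le> 1\<close> makes
  \<open>G\<close> grow at least linearly, so \<open>W\<close> exists on the whole half-line. The
  \<open>P\<close> obtained here is the derivative of \<open>W\<close> as a function of
  \<open>r\<close>, whereas inside the proof \<open>P\<close> is a function of the value
  \<open>v\<close>.\<close>

lemma supersolution_profile:
  fixes f :: "real \<Rightarrow> real" and a :: real
  assumes fpos: "\<And>s. 0 \<le> s \<Longrightarrow> 0 < f s" and fc: "continuous_on {0..} f"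
    and fint: "(f has_integral 1) {0..}" and a: "0 < a"
  obtains W P where "W 0 = a" "\<And>r s. 0 \<le> r \<Longrightarrow> r \<le> s \<Longrightarrow> W r \<le> W s"
    "continuous_on {0..} W"
    "\<And>r. 0 < r \<Longrightarrow> (W has_real_derivative P r) (at r)"
    "\<And>r. 0 < r \<Longrightarrow> (P has_real_derivative - f (W r)) (at r)"
proof -
  define F where "F s = 1 - integral {0..s} f" for s
  have F: "(F has_real_derivative - f s) (at s)" if "0 < s" for s
  proof -
    have "((\<lambda>x. integral {0..x} f) has_real_derivative f s) (at s within {0..s+1})"
      using that by (intro integral_has_real_derivative continuous_on_subset[OF fc]) auto
    moreover have "at s within {0..s+1} = at s" using that by (intro at_within_interior) auto
    ultimately show ?thesis unfolding F_def by (auto intro!: derivative_eq_intros)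
  qed
  have F0: "0 \<le> F s" "F s \<le> 1" if "0 \<le> s" for s
  proof -
    have i: "f integrable_on {0..s}"
      by (intro integrable_continuous_real continuous_on_subset[OF fc]) auto
    have "integral {0..s} f \<le> integral {0..} f"
      using has_integral_integrable[OF fint] fpos i by (intro integral_subset_le) (simp_all add: less_imp_le)
    moreover have "0 \<le> integral {0..s} f"
      using fpos i by (intro integral_nonneg) (simp_all add: less_imp_le)
    ultimately show "0 \<le> F s" "F s \<le> 1" using integral_unique[OF fint] by (simp_all add: F_def)
  qed
  have Fpos: "0 < F s" if "0 < s" for s
  proof -
    \<comment> \<open>\<open>F\<close> is strictly decreasing and still nonnegative one unit later,
      hence positive now.\<close>
    have "F (s + 1) < F s"
    proof (rule DERIV_neg_imp_decreasing[of s "s + 1" F])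
      show "\<exists>y. (F has_real_derivative y) (at x) \<and> y < 0" if "s \<le> x" "x \<le> s + 1" for x
        using F[of x] fpos[of x] that \<open>0 < s\<close> by (intro exI[of _ "- f x"]) simp
    qed simp
    then show ?thesis using F0(1)[of "s + 1"] that by simp
  qed
  define P where "P v = sqrt (2 * F v)" for v
  have Ppos: "0 < P v" if "0 < v" for v using Fpos[OF that] by (simp add: P_def)
  have P2: "P v \<le> 2" if "0 < v" for v
    using F0(2)[of v] that real_sqrt_le_mono[of "2 * F v" 4] by (simp add: P_def)
  have dP: "(P has_real_derivative - f v / P v) (at v)" if "0 < v" for v
    unfolding P_def using Fpos[OF that]
    by (auto intro!: derivative_eq_intros F[OF that] simp: field_simps)
  have Pc: "continuous_on {a/2..} P"
    using a by (intro continuous_at_imp_continuous_on ballI DERIV_isCont[OF dP]) auto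
  \<comment> \<open>Integrating from \<open>a/2\<close> makes \<open>a\<close> an interior point, so
    \<open>G\<close> has a two-sided derivative there as well; the subtracted constant normalises
    \<open>G a = 0\<close>.\<close>
  define G where "G v = integral {a/2..v} (\<lambda>s. 1 / P s) - integral {a/2..a} (\<lambda>s. 1 / P s)" for v
  have dG: "(G has_real_derivative 1 / P v) (at v)" if "a \<le> v" for v
  proof -
    have "P s \<noteq> 0" if "a/2 \<le> s" for s using Ppos[of s] that a by auto
    then have "((\<lambda>x. integral {a/2..x} (\<lambda>s. 1 / P s)) has_real_derivative 1 / P v) (at v within {a/2..v+1})"
      using that a by (intro integral_has_real_derivative continuous_intros continuous_on_subset[OF Pc]) auto
    moreover have "at v within {a/2..v+1} = at v" using that a by (intro at_within_interior) auto
    ultimately show ?thesis unfolding G_def by (auto intro!: derivative_eq_intros)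
  qed
  have Ga: "G a = 0" by (simp add: G_def)
  have Ggrow: "(y - x) / 2 \<le> G y - G x" if "a \<le> x" "x \<le> y" for x y
  proof -
    have "G x - x / 2 \<le> G y - y / 2"
    proof (rule DERIV_nonneg_imp_nondecreasing[where f="\<lambda>z. G z - z / 2", OF that(2)])
      fix z assume "x \<le> z" "z \<le> y"
      then have z: "a \<le> z" "0 < z" using that a by auto
      have "1 / 2 \<le> 1 / P z" using Ppos[OF z(2)] P2[OF z(2)] by (intro divide_left_mono) auto
      moreover have "((\<lambda>z. G z - z / 2) has_real_derivative 1 / P z - 1 / 2) (at z)"
        by (auto intro!: derivative_eq_intros dG[OF z(1)])
      ultimately show "\<exists>d. ((\<lambda>z. G z - z / 2) has_real_derivative d) (at z) \<and> 0 \<le> d" by force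
    qed
    then show ?thesis by (simp add: field_simps)
  qed
  have "\<exists>v\<ge>a. G v = r" if "0 \<le> r" for r
  proof -
    \<comment> \<open>Growth at rate at least \<open>1/2\<close> gives
      \<open>G (a + 2 * r) \<ge> r\<close>, so the value \<open>r\<close> is attained on this
      interval.\<close>
    have "continuous_on {a..a + 2 * r} G"
      by (intro continuous_at_imp_continuous_on ballI DERIV_isCont[OF dG]) auto
    then show ?thesis
      using IVT'[of G a r "a + 2 * r"] Ggrow[of a "a + 2 * r"] Ga that by auto
  qed
  then obtain W where W: "\<And>r. 0 \<le> r \<Longrightarrow> a \<le> W r" "\<And>r. 0 \<le> r \<Longrightarrow> G (W r) = r" by metis
  have W0: "W 0 = a" using Ggrow[of a "W 0"] W[of 0] Ga by simp
  have mono: "W r \<le> W s" if "0 \<le> r" "r \<le> s" for r s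
  proof (rule ccontr)
    assume "\<not> W r \<le> W s"
    then show False using Ggrow[of "W s" "W r"] W[of r] W[of s] that by simp
  qed
  \<comment> \<open>The lower growth bound for \<open>G\<close> becomes a Lipschitz bound for its
    inverse. It supplies the continuity that the inverse function rule requires.\<close>
  have lip: "W s - W r \<le> 2 * (s - r)" if "0 \<le> r" "r \<le> s" for r s
    using Ggrow[of "W r" "W s"] mono[OF that] W[of r] W[of s] that by simp
  have Wc: "continuous_on {0..} W"
    unfolding continuous_on_iff
  proof (intro ballI allI impI)
    fix x e :: real assume "x \<in> {0..}" "0 < e"
    moreover have "dist (W y) (W x) \<le> 2 * dist y x" if "0 \<le> x" "0 \<le> y" for x y
      using lip[of x y] lip[of y x] mono[of x y] mono[of y x] that by (auto simp: dist_real_def abs_if)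
    ultimately show "\<exists>d>0. \<forall>x'\<in>{0..}. dist x' x < d \<longrightarrow> dist (W x') (W x) < e"
      by (intro exI[of _ "e / 2"]) fastforce
  qed
  have dW: "(W has_real_derivative P (W r)) (at r)" if r: "0 < r" for r
  proof -
    have "0 < P (W r)" using Ppos[of "W r"] W(1)[of r] r a by simp
    moreover have "isCont W r"
      using continuous_on_interior[OF Wc, of r] r by auto
    ultimately have "(W has_real_derivative inverse (1 / P (W r))) (at r)"
      using r W by (intro DERIV_inverse_function[where f=G and a=0 and b="r + 1"] dG) auto
    then show ?thesis by simp
  qed
  have dPW: "((\<lambda>r. P (W r)) has_real_derivative - f (W r)) (at r)" if r: "0 < r" for r
  proof -
    have "0 < W r" using W(1)[of r] r a by simp
    from DERIV_chain2[OF dP[OF this] dW[OF r]] show ?thesis using Ppos[OF \<open>0 < W r\<close>] by simp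
  qed
  show thesis by (rule that[OF W0 mono Wc dW dPW])
qed

section \<open>Integral lower bound and first touching time\<close>

text \<open>Turns a pointwise bound on the boundary layer into a bound on the nonlocal term.
  Continuity on the compact closure makes \<open>g\<close> bounded, hence integrable on
  \<open>S\<close> and on \<open>N\<close>.\<close>

lemma integral_ge_of_subset_bound:
  fixes g :: "'a::euclidean_space \<Rightarrow> real"
  assumes S: "S \<in> lmeasurable" and N: "N \<in> lmeasurable" "N \<subseteq> S"
    and g: "continuous_on (closure S) g" "compact (closure S)"
    and nn: "\<And>x. x \<in> S \<Longrightarrow> 0 \<le> g x" and c: "\<And>x. x \<in> N \<Longrightarrow> c \<le> g x"
  shows "c * measure lebesgue N \<le> integral S g"
proof -
  obtain B where B: "\<And>x. x \<in> closure S \<Longrightarrow> norm (g x) \<le> B"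
    using compact_imp_bounded[OF compact_continuous_image[OF g]] by (auto simp: bounded_iff)
  have int: "g integrable_on A" if A: "A \<in> lmeasurable" "A \<subseteq> S" for A
  proof (rule measurable_bounded_by_integrable_imp_integrable)
    show "g \<in> borel_measurable (lebesgue_on A)"
      using A closure_subset by (intro continuous_imp_measurable_on_sets_lebesgue continuous_on_subset[OF g(1)]) auto
    show "(\<lambda>x. B) integrable_on A" using A by (intro integrable_on_const)
    show "norm (g x) \<le> B" if "x \<in> A" for x using that A B closure_subset by blast
  qed (use A in auto)
  have "c * measure lebesgue N = integral N (\<lambda>x. c)"
    using lmeasure_integral[OF N(1)] integral_mult_right[of N c "\<lambda>x. 1"] by simp
  also have "\<dots> \<le> integral N g"
    using N int c by (intro integral_le integrable_on_const) auto
  also have "\<dots> \<le> integral S g"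
    using N S int nn by (intro integral_subset_le) auto
  finally show ?thesis .
qed

text \<open>The set where \<open>v\<close> is nonnegative is compact, so its projection to the time
  axis has a least element \<open>t\<close>, positive by the initial condition. Left limits at
  \<open>t\<close> give \<open>v \<le> 0\<close> on all of \<open>K\<close>, which forces equality
  at the touching point.\<close>

lemma first_touching_time:
  fixes v :: "'a::metric_space \<Rightarrow> real \<Rightarrow> real"
  assumes K: "compact K" and vc: "continuous_on (K \<times> {0..T}) (\<lambda>(x, t). v x t)"
    and init: "\<And>x. x \<in> K \<Longrightarrow> v x 0 < 0" and hit: "x1 \<in> K" "0 \<le> T" "0 \<le> v x1 T"
  obtains x t where "x \<in> K" "0 < t" "t \<le> T" "v x t = 0" "\<And>y s. y \<in> K \<Longrightarrow> 0 \<le> s \<Longrightarrow> s < t \<Longrightarrow> v y s < 0"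
    "\<And>y. y \<in> K \<Longrightarrow> v y t \<le> 0"
proof -
  define H where "H = (K \<times> {0..T}) \<inter> (\<lambda>(x, t). v x t) -` {0..}"
  have "closed H" unfolding H_def
    using K by (intro continuous_closed_preimage[OF vc] compact_imp_closed[OF compact_Times]) auto
  then have "compact H"
    using compact_Int_closed[of "K \<times> {0..T}" H] K by (simp add: H_def compact_Times Int_absorb1 Int_left_absorb)
  then have "compact (snd ` H)" by (intro compact_continuous_image continuous_intros)
  moreover have "T \<in> snd ` H" using hit by (force simp: H_def)
  ultimately obtain t where t: "t \<in> snd ` H" "\<And>s. s \<in> snd ` H \<Longrightarrow> t \<le> s"
    using compact_attains_inf[of "snd ` H"] by blast
  then obtain x where x: "x \<in> K" "0 \<le> t" "t \<le> T" "0 \<le> v x t" by (auto simp: H_def)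
  have before: "v y s < 0" if "y \<in> K" "0 \<le> s" "s < t" for y s
    using t(2)[of s] that x by (force simp: H_def)
  have "t \<noteq> 0" using init x by force
  then have t0: "0 < t" using x by simp
  have le: "v y t \<le> 0" if y: "y \<in> K" for y
  proof -
    have "continuous_on {0..t} (\<lambda>s. v y s)"
    proof -
      have "continuous_on {0..t} (\<lambda>s. (y, s))" by (intro continuous_intros)
      then show ?thesis using continuous_on_compose2[OF vc, of "{0..t}" "\<lambda>s. (y, s)"] y x by force
    qed
    then have "continuous (at t within {0..t}) (v y)"
      using t0 by (auto simp: continuous_on_eq_continuous_within)
    then have "(v y \<longlongrightarrow> v y t) (at t within {0..t})" by (simp add: continuous_within)
    moreover have "at t within {0..t} \<noteq> bot" using t0 by (simp add: at_within_Icc_at_left)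
    moreover have "\<forall>\<^sub>F s in at t within {0..t}. v y s \<le> 0"
      using before[OF y] by (auto simp: eventually_at_filter intro!: always_eventually intro: less_imp_le)
    ultimately show ?thesis using tendsto_upperbound by blast
  qed
  show thesis
    using x t0 before le le[OF x(1)] by (intro that[of x t]) auto
qed

section \<open>The global bound\<close>

text \<open>Global boundedness is expressed by choosing \<open>C\<close> before \<open>T\<close> and
  \<open>u\<close>: one constant serves every solution on every time interval.\<close>

theorem theorem2p9:
  fixes \<Omega> :: "(real^'n) set" and p lam :: real and f :: "real \<Rightarrow> real"
    and u0 :: "real^'n \<Rightarrow> real"
  assumes dom: "smooth_bounded_domain \<Omega>" and cvx: "convex \<Omega>"
    and tang: "\<forall>y0\<in>frontier \<Omega>. \<exists>S. tangent_hyperplane \<Omega> y0 S \<and> S \<inter> frontier \<Omega> = {y0}"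
    and p: "1 < p" "p < 2" and lam: "lam > 0"
    and fpos: "\<forall>s\<ge>0. f s > 0"
    and fder: "\<exists>f'. \<forall>s\<ge>0. (f has_real_derivative f' s) (at s within {0..}) \<and> f' s < 0"
    and fint: "(f has_integral 1) {0..}"
    and u0c: "continuous_on (closure \<Omega>) u0"
    and u0nn: "\<forall>x\<in>\<Omega>. u0 x \<ge> 0"
    and u0bd: "\<forall>x\<in>frontier \<Omega>. u0 x = 0"
  shows "\<exists>C. \<forall>T>0. \<forall>u. classical_solution \<Omega> lam p f u0 T u \<longrightarrow>
           (\<forall>x\<in>closure \<Omega>. \<forall>t\<in>{0..<T}. u x t \<le> C)"
proof -
  have op: "open \<Omega>" and ne: "\<Omega> \<noteq> {}" and bdd: "bounded \<Omega>"
    using dom by (auto simp: smooth_bounded_domain_def)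
  let ?K = "closure \<Omega>" and ?D = "\<lambda>x. infdist x (frontier \<Omega>)"
  have cK: "compact ?K" using bdd by simp
  have lm: "\<Omega> \<in> lmeasurable" by (simp add: bdd op lmeasurable_open)
  have frne: "frontier \<Omega> \<noteq> {}" using ne bdd frontier_eq_empty not_bounded_UNIV by blast
  have fc: "continuous_on {0..} f"
    using fder by (auto simp: continuous_on_eq_continuous_within intro: DERIV_continuous)
  have fdec: "f s \<le> f r" if "0 \<le> r" "r \<le> s" for r s
  proof (rule ccontr)
    obtain f' where f': "\<And>s. 0 \<le> s \<Longrightarrow> (f has_real_derivative f' s) (at s within {0..}) \<and> f' s < 0"
      using fder by blast
    assume *: "\<not> f s \<le> f r"
    then have "r < s" using that by (cases "r = s") auto
    \<comment> \<open>At 0 the derivative is only one-sided, so the argument uses derivatives in the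
      open interval and continuity at the endpoints.\<close>
    then have "f s < f r"
    proof (rule DERIV_neg_imp_decreasing_open[of r s f])
      fix x assume "r < x" "x < s"
      then have "at x within {0..} = at x" using that by (intro at_within_interior) auto
      then show "\<exists>y. (f has_real_derivative y) (at x) \<and> y < 0"
        using f'[of x] \<open>r < x\<close> that by auto
    qed (use that in \<open>auto intro: continuous_on_subset[OF fc]\<close>)
    with * show False by simp
  qed

  \<comment> \<open>Choice of the constants and of the barrier\<close>
  obtain z where z: "z \<in> \<Omega>" using ne by blast
  obtain R where R0: "0 < R" and R: "\<Omega> \<subseteq> cball z R"
    using bounded_subset_ballD[OF bdd, of z] ball_subset_cball by blast
  have mpos: "0 < measure lebesgue \<Omega>"
  proof -
    obtain e where e: "0 < e" "ball z e \<subseteq> \<Omega>" using op z open_contains_ball by blast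
    then have "measure lebesgue (ball z e) \<le> measure lebesgue \<Omega>"
      using lm by (intro measure_mono_fmeasurable) auto
    moreover have "0 < measure lebesgue (ball z e)" using e by (simp add: content_ball_pos)
    ultimately show ?thesis by linarith
  qed
  obtain a where a: "0 < a" "\<And>x. x \<in> ?K \<Longrightarrow> u0 x < a"
  proof -
    obtain B where "\<And>x. x \<in> ?K \<Longrightarrow> norm (u0 x) \<le> B"
      using compact_imp_bounded[OF compact_continuous_image[OF u0c cK]] by (auto simp: bounded_iff)
    then show thesis by (intro that[of "\<bar>B\<bar> + 1"]) force+
  qed
  obtain W P where W0: "W 0 = a" and Wmono: "\<And>r s. 0 \<le> r \<Longrightarrow> r \<le> s \<Longrightarrow> W r \<le> W s"
    and Wc: "continuous_on {0..} W"
    and dW: "\<And>r. 0 < r \<Longrightarrow> (W has_real_derivative P r) (at r)"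
    and dP: "\<And>r. 0 < r \<Longrightarrow> (P has_real_derivative - f (W r)) (at r)"
    using supersolution_profile[OF _ fc fint a(1)] fpos by blast
  have Wa: "a \<le> W r" if "0 \<le> r" for r using Wmono[of 0 r] W0 that by simp

  \<comment> \<open>On the layer the barrier is at most \<open>W (2 * R)\<close>, whatever
    \<open>d\<close> is, and the layer has measure at least
    \<open>d * measure lebesgue \<Omega>\<close>; so \<open>c * d\<close> will bound the integral of
    \<open>f(u)\<close> from below.\<close>
  define c where "c = f (W (2 * R)) * measure lebesgue \<Omega>"
  have c: "0 < c" using fpos Wa[of "2 * R"] R0 a mpos by (simp add: c_def)
  obtain d where d: "0 < d" "d \<le> 1/2" and dsmall: "lam / (c * d) powr p < 1 / d\<^sup>2"
  proof -
    \<comment> \<open>The second entry solves \<open>lam * d powr (2 - p) = c powr p / 2\<close>,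
      the factor 2 making the final inequality strict. The cap \<open>1/2\<close> is what the layer
      estimate requires.\<close>
    define d where "d = min (1/2) ((c powr p / (2 * lam)) powr (1 / (2 - p)))"
    have d: "0 < d" "d \<le> 1/2" using c lam by (auto simp: d_def)
    have "d powr (2 - p) \<le> ((c powr p / (2 * lam)) powr (1 / (2 - p))) powr (2 - p)"
      using d p by (intro powr_mono2) (auto simp: d_def)
    also have "\<dots> = c powr p / (2 * lam)" using c lam p by (simp add: powr_powr)
    also have "\<dots> < c powr p / lam" using c lam by (simp add: field_simps)
    finally have "lam * d powr (2 - p) < c powr p" using lam by (simp add: field_simps)
    moreover have "d powr 2 = d powr (2 - p) * d powr p" by (simp flip: powr_add)
    then have "d\<^sup>2 = d powr (2 - p) * d powr p" using d by simp
    ultimately have "lam * d\<^sup>2 < (c * d) powr p"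
      using c d by (simp add: powr_mult mult.assoc[symmetric])
    then have "lam / (c * d) powr p < 1 / d\<^sup>2" using c d by (simp add: field_simps)
    with d show thesis by (rule that)
  qed
  obtain N where N: "N \<in> lmeasurable" "N \<subseteq> \<Omega>" "d * measure lebesgue \<Omega> \<le> measure lebesgue N"
    "\<And>x. x \<in> N \<Longrightarrow> ?D x \<le> 2 * R * d"
    using boundary_layer_measure[OF op cvx z R d] by blast
  define V where "V r = W (r / d)" for r
  have dV: "(V has_real_derivative P (r / d) / d) (at r)" if "0 < r" for r
    unfolding V_def using d that by (intro DERIV_chain2[OF dW, THEN DERIV_cong]) (auto intro!: derivative_eq_intros)
  have dV2: "((\<lambda>r. P (r / d) / d) has_real_derivative - f (V r) / d\<^sup>2) (at r)" if "0 < r" for r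
  proof -
    have "((\<lambda>r. P (r / d)) has_real_derivative - f (V r) * (1 / d)) (at r)"
      unfolding V_def using d that by (intro DERIV_chain2[OF dP]) (auto intro!: derivative_eq_intros)
    from DERIV_cdivide[OF this, of d] show ?thesis by (simp add: power2_eq_square)
  qed
  have Vmono: "V r \<le> V s" if "0 \<le> r" "r \<le> s" for r s
    unfolding V_def using d that by (intro Wmono) (auto simp: divide_right_mono)
  have Va: "a \<le> V r" if "0 \<le> r" for r unfolding V_def using d that by (intro Wa) auto
  have VDc: "continuous_on ?K (\<lambda>x. V (?D x))"
    unfolding V_def using d
    by (intro continuous_on_compose2[OF Wc] continuous_intros) (auto simp: infdist_nonneg)
  obtain C where C: "\<And>x. x \<in> ?K \<Longrightarrow> V (?D x) \<le> C"
    using bounded_imp_bdd_above[OF compact_imp_bounded[OF compact_continuous_image[OF VDc cK]]]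
    by (auto simp: bdd_above_def)

  \<comment> \<open>Comparison of the solution with the barrier\<close>
  have bound: "u x t < V (?D x)"
    if sol: "classical_solution \<Omega> lam p f u0 T u" and x: "x \<in> ?K" and t: "0 \<le> t" "t < T" for T u x t
  proof (rule ccontr)
    have uc: "continuous_on (?K \<times> {0..<T}) (\<lambda>(x, t). u x t)"
      and unn: "\<And>x t. x \<in> ?K \<Longrightarrow> 0 \<le> t \<Longrightarrow> t < T \<Longrightarrow> 0 \<le> u x t"
      and uinit: "\<And>x. x \<in> ?K \<Longrightarrow> u x 0 = u0 x"
      and ubd: "\<And>x t. x \<in> frontier \<Omega> \<Longrightarrow> 0 < t \<Longrightarrow> t < T \<Longrightarrow> u x t = 0"
      and uC2: "\<And>t. 0 < t \<Longrightarrow> t < T \<Longrightarrow> Ck_on 2 \<Omega> (\<lambda>x. u x t)"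
      and ueq: "\<And>x t. x \<in> \<Omega> \<Longrightarrow> 0 < t \<Longrightarrow> t < T \<Longrightarrow> ((\<lambda>s. u x s) has_real_derivative
           (laplacian \<Omega> (\<lambda>y. u y t) x + lam * f (u x t) / (integral \<Omega> (\<lambda>y. f (u y t))) powr p)) (at t)"
      using sol unfolding classical_solution_def by auto
    define v where "v x t = u x t - V (?D x)" for x t
    assume "\<not> u x t < V (?D x)"
    then have hit: "0 \<le> v x t" by (simp add: v_def)
    have "continuous_on (?K \<times> {0..t}) (\<lambda>z. (case z of (x, t) \<Rightarrow> u x t) - V (?D (fst z)))"
      using t by (intro continuous_on_diff continuous_on_subset[OF uc]
          continuous_on_compose2[OF VDc] continuous_intros) auto
    then have vc: "continuous_on (?K \<times> {0..t}) (\<lambda>(x, t). v x t)"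
      by (simp add: v_def case_prod_unfold)
    have init: "v y 0 < 0" if "y \<in> ?K" for y
      using a(2)[OF that] uinit[OF that] Va[of "?D y"] by (simp add: v_def infdist_nonneg)
    obtain x0 t0 where x0: "x0 \<in> ?K" and t0: "0 < t0" "t0 \<le> t" and v0: "v x0 t0 = 0"
      and before: "\<And>y s. y \<in> ?K \<Longrightarrow> 0 \<le> s \<Longrightarrow> s < t0 \<Longrightarrow> v y s < 0"
      and le: "\<And>y. y \<in> ?K \<Longrightarrow> v y t0 \<le> 0"
      using first_touching_time[OF cK vc init x t(1) hit] by blast
    have t0T: "t0 < T" using t0 t by simp
    have u0V: "u x0 t0 = V (?D x0)" using v0 by (simp add: v_def)
    \<comment> \<open>On the frontier \<open>u\<close> vanishes while the barrier is at least
      \<open>a > 0\<close>.\<close>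
    have "x0 \<notin> frontier \<Omega>"
      using ubd[of x0 t0] t0 t0T u0V Va[of "?D x0"] a(1) by (auto simp: infdist_nonneg)
    then have x0\<Omega>: "x0 \<in> \<Omega>" using x0 op by (auto simp: frontier_def interior_open)
    obtain y0 where y0: "y0 \<in> frontier \<Omega>" "?D x0 = dist x0 y0"
      using infdist_attains_inf[OF frontier_closed frne] by blast
    obtain e where e: "norm e = 1" "\<And>x. x \<in> \<Omega> \<Longrightarrow> 0 < e \<bullet> y0 - e \<bullet> x"
      "\<And>x. x \<in> \<Omega> \<Longrightarrow> ?D x \<le> e \<bullet> y0 - e \<bullet> x"
      using supporting_halfspace_infdist[OF op cvx ne y0(1)] by blast
    \<comment> \<open>Because \<open>y0\<close> is the nearest frontier point, Cauchy-Schwarz gives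
      the reverse inequality: the affine function equals the distance at \<open>x0\<close>.\<close>
    have "e \<bullet> y0 - e \<bullet> x0 \<le> dist x0 y0"
      using norm_cauchy_schwarz[of e "y0 - x0"] e(1)
      by (simp add: inner_diff_right dist_norm norm_minus_commute)
    then have D0: "?D x0 = e \<bullet> y0 - e \<bullet> x0" using e(3)[OF x0\<Omega>] y0(2) by simp
    \<comment> \<open>The distance function may fail to be differentiable, so \<open>u\<close> is
      compared with \<open>V\<close> of the affine function, which dominates \<open>V (?D y)\<close>
      by monotonicity and agrees with it at \<open>x0\<close>.\<close>
    have lap: "laplacian \<Omega> (\<lambda>y. u y t0) x0 \<le> - f (V (?D x0)) / d\<^sup>2"
    proof (rule laplacian_le_of_touching[OF uC2[OF t0(1) t0T] x0\<Omega> e(1,2), where V=V and V'="\<lambda>r. P (r / d) / d"])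
      fix y assume y: "y \<in> \<Omega>"
      then have "u y t0 \<le> V (?D y)" using le[of y] closure_subset by (auto simp: v_def)
      also have "\<dots> \<le> V (e \<bullet> y0 - e \<bullet> y)" using e(3)[OF y] by (intro Vmono) (auto simp: infdist_nonneg)
      finally show "u y t0 \<le> V (e \<bullet> y0 - e \<bullet> y)" .
    next
      show "((\<lambda>r. P (r / d) / d) has_real_derivative - f (V (?D x0)) / d\<^sup>2) (at (e \<bullet> y0 - e \<bullet> x0))"
        using dV2[of "?D x0"] e(2)[OF x0\<Omega>] by (simp add: D0)
    qed (use u0V D0 dV in auto)
    define I where "I = integral \<Omega> (\<lambda>y. f (u y t0))"
    have I: "c * d \<le> I"
    proof -
      have "continuous_on ?K (\<lambda>y. u y t0)"
      proof -
        have "continuous_on ?K (\<lambda>y. (y, t0))" by (intro continuous_intros)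
        then show ?thesis
          using continuous_on_compose2[OF uc, of ?K "\<lambda>y. (y, t0)"] t0 t0T by force
      qed
      then have fuc: "continuous_on ?K (\<lambda>y. f (u y t0))"
        using unn t0 t0T by (intro continuous_on_compose2[OF fc]) auto
      have sub: "\<And>y. y \<in> \<Omega> \<Longrightarrow> y \<in> ?K" using closure_subset by blast
      have "c * d \<le> f (W (2 * R)) * measure lebesgue N"
        using N(3) fpos Wa[of "2 * R"] a R0 by (simp add: c_def mult.assoc mult.commute[of _ d])
      also have "\<dots> \<le> I" unfolding I_def
      proof (rule integral_ge_of_subset_bound[OF lm N(1,2) fuc cK])
        show "0 \<le> f (u y t0)" if "y \<in> \<Omega>" for y
          using fpos unn[of y t0] sub[OF that] t0 t0T by (simp add: less_imp_le)
        fix y assume y: "y \<in> N"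
        then have yK: "y \<in> ?K" using N(2) sub by blast
        \<comment> \<open>An upper bound on \<open>u\<close> yields a lower bound on
          \<open>f(u)\<close> because \<open>f\<close> is decreasing.\<close>
        have "u y t0 \<le> V (?D y)" using le[OF yK] by (simp add: v_def)
        also have "\<dots> \<le> V (2 * R * d)" using N(4)[OF y] by (intro Vmono) (auto simp: infdist_nonneg)
        also have "\<dots> = W (2 * R)" using d by (simp add: V_def)
        finally show "f (W (2 * R)) \<le> f (u y t0)"
          using unn[OF yK] t0 t0T by (intro fdec) auto
      qed
      finally show ?thesis .
    qed
    have fV: "0 < f (V (?D x0))" using fpos Va[of "?D x0"] a(1) by (simp add: infdist_nonneg)
    have "0 < c * d" using c d by simp
    then have "lam / I powr p \<le> lam / (c * d) powr p"
      using I lam p by (intro divide_left_mono powr_mono2 mult_pos_pos) auto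
    then have "lam / I powr p < 1 / d\<^sup>2" using dsmall by simp
    from mult_strict_right_mono[OF this fV]
    have neg: "laplacian \<Omega> (\<lambda>y. u y t0) x0 + lam * f (u x0 t0) / I powr p < 0"
      using lap u0V by simp
    \<comment> \<open>A negative time derivative puts \<open>u\<close> above the time-independent
      barrier slightly before \<open>t0\<close>, contradicting the choice of \<open>t0\<close> as
      first touching time.\<close>
    obtain s where s: "0 < s" "\<And>h. 0 < h \<Longrightarrow> h < s \<Longrightarrow> u x0 t0 < u x0 (t0 - h)"
      using DERIV_neg_dec_left[OF ueq[OF x0\<Omega> t0(1) t0T]] neg by (auto simp: I_def)
    define h where "h = min s t0 / 2"
    have h: "0 < h" "h < s" "h < t0" using s t0 by (auto simp: h_def)
    show False
      using s(2)[OF h(1,2)] before[OF x0, of "t0 - h"] h v0 unfolding v_def by linarith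
  qed
  have "u x t \<le> C"
    if "classical_solution \<Omega> lam p f u0 T u" "x \<in> ?K" "t \<in> {0..<T}" for T u x t
    using bound[OF that(1,2), of t] C[OF that(2)] that(3) by simp
  then show ?thesis by blast
qed

end
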